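(* Let $\mathscr{H}$ be a complex Hilbert space and let $\sharp:\mathbb{B}(\mathscr{H})\to\mathbb{B}(\mathscr{H})$ be a $*$-conjugate-automorphism. Then there exists a conjugate-linear unitary operator $U:\mathscr{H}\to\mathscr{H}$ such that $T^\sharp=UTU^{-1}$ for all $T\in\mathbb{B}(\mathscr{H})$.
   Context: A $*$-conjugate-automorphism on a $C^*$-algebra $\mathscr{A}$ is a map $\sharp:\mathscr{A}\to\mathscr{A}$, $a\mapsto a^\sharp$, such that for all $a,b\in\mathscr{A}$, $\lambda\in\mathbb{C}$: (1) $(\lambda a+b)^\sharp=\bar\lambda a^\sharp+b^\sharp$; (2) $(a^\sharp)^\sharp=a$; (3) $(a^\sharp)^*=(a^* )^\sharp$; (4) $(ab)^\sharp=a^\sharp b^\sharp$. $\mathbb{B}(\mathscr{H})$ is the algebra of bounded linear operators on $\mathscr{H}$. A conjugate-linear operator $U:\mathscr{H}\to\mathscr{H}$ is called conjugate-linear unitary if it is surjective and $\langle Ux,Uy\rangle=\langle y,x\rangle$ for all $x,y\in\mathscr{H}$. *)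

theory Defs
  imports "HOL-Analysis.Analysis"
begin

text \<open>
  Complex Hilbert spaces, as a type class on top of the real Banach spaces of HOL-Analysis.
  The inner product is linear in its first argument. The zero space is included.
\<close>

class complex_hilbert = banach +
  fixes scaleC :: "complex \<Rightarrow> 'a \<Rightarrow> 'a" (infixr "*\<^sub>C" 75)
    and cinner :: "'a \<Rightarrow> 'a \<Rightarrow> complex"
  assumes scaleC_add_right: "c *\<^sub>C (x + y) = c *\<^sub>C x + c *\<^sub>C y"
    and scaleC_add_left: "(c + d) *\<^sub>C x = c *\<^sub>C x + d *\<^sub>C x"
    and scaleC_scaleC: "c *\<^sub>C d *\<^sub>C x = (c * d) *\<^sub>C x"
    and scaleR_scaleC: "r *\<^sub>R x = complex_of_real r *\<^sub>C x"
    and cinner_commute: "cinner x y = cnj (cinner y x)"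
    and cinner_add_left: "cinner (x + y) z = cinner x z + cinner y z"
    and cinner_scaleC_left: "cinner (c *\<^sub>C x) y = c * cinner x y"
    and cinner_ge_zero: "0 \<le> Re (cinner x x)"
    and cinner_eq_zero_iff: "cinner x x = 0 \<longleftrightarrow> x = 0"
    and norm_eq_sqrt_cinner: "norm x = sqrt (Re (cinner x x))"

instantiation complex :: complex_hilbert
begin

definition scaleC_complex :: "complex \<Rightarrow> complex \<Rightarrow> complex"
  where "scaleC_complex c x = c * x"

definition cinner_complex :: "complex \<Rightarrow> complex \<Rightarrow> complex"
  where "cinner_complex x y = x * cnj y"

instance
proof
  fix c d x y z :: complex and r :: real
  show "c *\<^sub>C (x + y) = c *\<^sub>C x + c *\<^sub>C y" "(c + d) *\<^sub>C x = c *\<^sub>C x + d *\<^sub>C x"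
    "c *\<^sub>C d *\<^sub>C x = (c * d) *\<^sub>C x" "cinner (x + y) z = cinner x z + cinner y z"
    "cinner (c *\<^sub>C x) y = c * cinner x y"
    by (simp_all add: scaleC_complex_def cinner_complex_def algebra_simps)
  show "r *\<^sub>R x = complex_of_real r *\<^sub>C x"
    by (simp add: scaleC_complex_def scaleR_conv_of_real)
  show "cinner x y = cnj (cinner y x)" "cinner x x = 0 \<longleftrightarrow> x = 0" "0 \<le> Re (cinner x x)"
    by (simp_all add: cinner_complex_def)
  show "norm x = sqrt (Re (cinner x x))"
    by (simp add: cinner_complex_def cmod_def power2_eq_square)
qed

end

definition bounded_ops :: "('a::complex_hilbert \<Rightarrow> 'a) set"
  where "bounded_ops = {T. bounded_linear T \<and> (\<forall>c x. T (c *\<^sub>C x) = c *\<^sub>C T x)}"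

text \<open>
  For a bounded operator the adjoint exists by the Riesz representation theorem, and it is
  unique because the inner product is definite.
\<close>

definition cadjoint :: "('a::complex_hilbert \<Rightarrow> 'a) \<Rightarrow> 'a \<Rightarrow> 'a"
  where "cadjoint T = (THE S. S \<in> bounded_ops \<and> (\<forall>x y. cinner (T x) y = cinner x (S y)))"

text \<open>
  The operations of the algebra of bounded operators are the pointwise linear structure,
  composition as product, and the adjoint as involution. The values of \<open>sharp\<close> outside
  \<^const>\<open>bounded_ops\<close> are irrelevant.
\<close>

definition star_conjugate_automorphism ::
    "(('a::complex_hilbert \<Rightarrow> 'a) \<Rightarrow> ('a \<Rightarrow> 'a)) \<Rightarrow> bool"
  where "star_conjugate_automorphism sharp \<longleftrightarrow>
    (\<forall>A\<in>bounded_ops. sharp A \<in> bounded_ops) \<and>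
    (\<forall>A\<in>bounded_ops. \<forall>B\<in>bounded_ops. \<forall>c.
       sharp (\<lambda>x. c *\<^sub>C A x + B x) = (\<lambda>x. cnj c *\<^sub>C sharp A x + sharp B x)) \<and>
    (\<forall>A\<in>bounded_ops. sharp (sharp A) = A) \<and>
    (\<forall>A\<in>bounded_ops. cadjoint (sharp A) = sharp (cadjoint A)) \<and>
    (\<forall>A\<in>bounded_ops. \<forall>B\<in>bounded_ops. sharp (A \<circ> B) = sharp A \<circ> sharp B)"

definition conjugate_linear :: "('a::complex_hilbert \<Rightarrow> 'a) \<Rightarrow> bool"
  where "conjugate_linear U \<longleftrightarrow>
    (\<forall>x y. U (x + y) = U x + U y) \<and> (\<forall>c x. U (c *\<^sub>C x) = cnj c *\<^sub>C U x)"

definition conjugate_linear_unitary :: "('a::complex_hilbert \<Rightarrow> 'a) \<Rightarrow> bool"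
  where "conjugate_linear_unitary U \<longleftrightarrow>
    conjugate_linear U \<and> surj U \<and> (\<forall>x y. cinner (U x) (U y) = cinner y x)"

end

theory Submission
  imports Defs
begin

text \<open>
  The automorphism maps the projection onto a unit vector \<open>e\<close> to a minimal self-adjoint idempotent,
  hence to the projection onto some unit vector \<open>f\<close>. Writing \<open>x \<otimes> e\<close> for the operator
  \<open>w \<mapsto> \<langle>w, e\<rangle> x\<close>, the map \<open>U x = (x \<otimes> e)\<^sup>\<sharp> f\<close> is conjugate-linear and satisfies
  \<open>(x \<otimes> e)\<^sup>\<sharp> = U x \<otimes> f\<close>. Applying \<open>\<sharp>\<close> to \<open>(e \<otimes> y)(x \<otimes> e) = \<langle>x, y\<rangle> (e \<otimes> e)\<close>
  shows that \<open>U\<close> is anti-isometric, and applying it to \<open>T (x \<otimes> e) = T x \<otimes> e\<close> shows that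
  \<open>T\<^sup>\<sharp> U = U T\<close>. Riesz representation enters only to see that the image of the projection,
  a priori of the form \<open>w \<mapsto> \<phi>(w) f\<close> with \<open>\<phi>\<close> a bounded functional, has an adjoint.
\<close>

section \<open>Complex Hilbert spaces\<close>

lemma scaleC_one [simp]: "1 *\<^sub>C x = (x::'a::complex_hilbert)"
  using scaleR_scaleC[of 1 x] by simp

lemma scaleC_zero_left [simp]: "0 *\<^sub>C x = (0::'a::complex_hilbert)"
  using scaleR_scaleC[of 0 x] by simp

lemma scaleC_zero_right [simp]: "c *\<^sub>C 0 = (0::'a::complex_hilbert)"
  using scaleC_add_right[of c 0 0] by simp

lemma scaleC_minus_left: "(- c) *\<^sub>C x = - (c *\<^sub>C (x::'a::complex_hilbert))"
  using scaleC_add_left[of c "- c" x] by (simp add: eq_neg_iff_add_eq_0 add.commute)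

lemma cinner_add_right:
  "cinner x (y + z) = cinner x y + cinner x (z::'a::complex_hilbert)"
  by (metis cinner_add_left cinner_commute complex_cnj_add)

lemma cinner_scaleC_right:
  "cinner x (c *\<^sub>C y) = cnj c * cinner x (y::'a::complex_hilbert)"
  by (metis cinner_commute cinner_scaleC_left complex_cnj_mult)

lemma cinner_minus_left: "cinner (- x) y = - cinner x (y::'a::complex_hilbert)"
  using cinner_scaleC_left[of "-1" x y] by (simp add: scaleC_minus_left)

lemma cinner_minus_right: "cinner x (- y) = - cinner x (y::'a::complex_hilbert)"
  using cinner_scaleC_right[of x "-1" y] by (simp add: scaleC_minus_left)

lemma cinner_diff_left:
  "cinner (x - y) z = cinner x z - cinner y (z::'a::complex_hilbert)"
  by (simp only: diff_conv_add_uminus cinner_add_left cinner_minus_left)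

lemma cinner_diff_right:
  "cinner x (y - z) = cinner x y - cinner x (z::'a::complex_hilbert)"
  by (simp only: diff_conv_add_uminus cinner_add_right cinner_minus_right)

lemma cinner_zero_left [simp]: "cinner 0 (x::'a::complex_hilbert) = 0"
  using cinner_scaleC_left[of 0 0 x] by simp

lemma cinner_zero_right [simp]: "cinner (x::'a::complex_hilbert) 0 = 0"
  using cinner_scaleC_right[of x 0 0] by simp

section \<open>Norm identities, least-norm vectors and Riesz representation\<close>

lemma cinner_self: "cinner x x = complex_of_real ((norm (x::'a::complex_hilbert))\<^sup>2)"
proof -
  have "Im (cinner x x) = 0"
    using arg_cong[OF cinner_commute[of x x], of Im] by simp
  then show ?thesis
    using cinner_ge_zero[of x] by (simp add: complex_eq_iff norm_eq_sqrt_cinner)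
qed

lemma norm_square_eq: "(norm (x::'a::complex_hilbert))\<^sup>2 = Re (cinner x x)"
  by (simp add: cinner_self)

lemma norm_scaleC: "norm (c *\<^sub>C x) = cmod c * norm (x::'a::complex_hilbert)"
proof -
  have "(norm (c *\<^sub>C x))\<^sup>2 = Re (c * cnj c * cinner x x)"
    by (simp add: norm_square_eq cinner_scaleC_left cinner_scaleC_right algebra_simps)
  also have "\<dots> = (cmod c * norm x)\<^sup>2"
    unfolding complex_norm_square[symmetric] cinner_self
    by (simp add: power_mult_distrib flip: of_real_mult of_real_power)
  finally show ?thesis
    by (simp add: power2_eq_iff_nonneg)
qed

lemma norm_add_square:
  "(norm (x + y))\<^sup>2 = (norm x)\<^sup>2 + (norm y)\<^sup>2 + 2 * Re (cinner x (y::'a::complex_hilbert))"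
  using arg_cong[OF cinner_commute[of y x], of Re]
  by (simp add: norm_square_eq cinner_add_left cinner_add_right)

lemma parallelogram_law:
  "(norm (x + y))\<^sup>2 + (norm (x - y))\<^sup>2
    = 2 * (norm x)\<^sup>2 + 2 * (norm (y::'a::complex_hilbert))\<^sup>2"
  by (simp add: norm_square_eq cinner_add_left cinner_add_right cinner_diff_left cinner_diff_right)

text \<open>The triangle inequality, squared, bounds the real part of the inner product. Multiplying
  \<open>x\<close> by a unimodular scalar first makes that real part equal to the modulus.\<close>

lemma Cauchy_Schwarz_cinner: "cmod (cinner x y) \<le> norm x * norm (y::'a::complex_hilbert)"
proof (cases "cinner x y = 0")
  case False
  define c where "c = cnj (sgn (cinner x y))"
  have c: "cmod c = 1"
    using False by (simp add: c_def norm_sgn)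
  have "cinner (c *\<^sub>C x) y = of_real (cmod (cinner x y))"
    using False
    by (simp add: cinner_scaleC_left c_def sgn_div_norm scaleR_conv_of_real field_simps
        complex_norm_square[symmetric] power2_eq_square flip: of_real_mult)
  moreover have "2 * Re (cinner (c *\<^sub>C x) y) \<le> 2 * (norm (c *\<^sub>C x) * norm y)"
    using power_mono[OF norm_triangle_ineq[of "c *\<^sub>C x" y] norm_ge_zero, of 2]
    by (simp add: norm_add_square power2_sum)
  ultimately show ?thesis
    using c by (simp add: norm_scaleC)
qed simp

lemma cinner_ext:
  assumes "\<And>z. cinner z x = cinner z (y::'a::complex_hilbert)"
  shows "x = y"
proof -
  have "cinner (x - y) (x - y) = 0"
    using assms[of "x - y"] by (simp add: cinner_diff_right)
  then show ?thesis
    by (simp add: cinner_eq_zero_iff)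
qed

text \<open>A norm-minimizing sequence is Cauchy by the parallelogram law; completeness gives a
  limit, which closedness keeps in \<open>C\<close>.\<close>

lemma exists_minimal_norm:
  fixes C :: "'a::complex_hilbert set"
  assumes "C \<noteq> {}" "closed C" "convex C"
  obtains x where "x \<in> C" "\<And>y. y \<in> C \<Longrightarrow> norm x \<le> norm y"
proof -
  define d where "d = Inf (norm ` C)"
  have bdd: "bdd_below (norm ` C)"
    by (rule bdd_belowI[of _ 0]) auto
  have d_le: "d \<le> norm y" if "y \<in> C" for y
    unfolding d_def using bdd that by (intro cInf_lower) auto
  have d0: "0 \<le> d"
    unfolding d_def using assms(1) by (intro cInf_greatest) auto
  have "\<exists>x\<in>C. norm x < d + 1 / Suc n" for n
    using cInf_lessD[of "norm ` C" "d + 1 / Suc n"] assms(1) by (auto simp: d_def)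
  then obtain X where XC: "X n \<in> C" and Xn: "norm (X n) < d + 1 / Suc n" for n
    by metis
  have lim: "(\<lambda>n. norm (X n)) \<longlonglongrightarrow> d"
  proof (rule tendsto_sandwich[of "\<lambda>_. d"])
    show "(\<lambda>n. d + 1 / Suc n) \<longlonglongrightarrow> d"
      using tendsto_add[OF tendsto_const LIMSEQ_inverse_real_of_nat, of d]
      by (simp add: inverse_eq_divide)
    show "\<forall>\<^sub>F n in sequentially. norm (X n) \<le> d + 1 / Suc n"
      using Xn by (intro always_eventually allI less_imp_le)
  qed (use d_le XC in auto)
  \<comment> \<open>By convexity the midpoint of \<open>X m\<close> and \<open>X n\<close> lies in
    \<open>C\<close>, so \<open>norm (X m + X n)\<close> is at least \<open>2 * d\<close>.\<close>
  have diff: "(norm (X m - X n))\<^sup>2 \<le> 2 * ((norm (X m))\<^sup>2 - d\<^sup>2) + 2 * ((norm (X n))\<^sup>2 - d\<^sup>2)" for m n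
  proof -
    have "(1/2) *\<^sub>R X m + (1/2) *\<^sub>R X n \<in> C"
      using assms(3) XC by (intro convexD) auto
    then have "d \<le> norm ((1/2) *\<^sub>R (X m + X n))"
      using d_le by (simp add: scaleR_right_distrib)
    then have "2 * d \<le> norm (X m + X n)"
      by simp
    then have "(2 * d)\<^sup>2 \<le> (norm (X m + X n))\<^sup>2"
      using d0 by (intro power_mono) auto
    with parallelogram_law[of "X m" "X n"] show ?thesis
      by (simp add: power_mult_distrib)
  qed
  have lim2: "(\<lambda>n. (norm (X n))\<^sup>2 - d\<^sup>2) \<longlonglongrightarrow> 0"
    using tendsto_diff[OF tendsto_power[OF lim, of 2] tendsto_const[of "d\<^sup>2"]] by simp
  have "Cauchy X"
  proof (rule CauchyI)
    fix e :: real
    assume "0 < e"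
    then have "\<forall>\<^sub>F n in sequentially. (norm (X n))\<^sup>2 - d\<^sup>2 < e\<^sup>2 / 4"
      by (intro order_tendstoD(2)[OF lim2]) auto
    then obtain N where N: "\<And>n. n \<ge> N \<Longrightarrow> (norm (X n))\<^sup>2 - d\<^sup>2 < e\<^sup>2 / 4"
      by (auto simp: eventually_sequentially)
    have "norm (X m - X n) < e" if "m \<ge> N" "n \<ge> N" for m n
    proof (rule power2_less_imp_less)
      show "(norm (X m - X n))\<^sup>2 < e\<^sup>2"
        using diff[of m n] N[OF that(1)] N[OF that(2)] by simp
    qed (use \<open>0 < e\<close> in simp)
    then show "\<exists>M. \<forall>m\<ge>M. \<forall>n\<ge>M. norm (X m - X n) < e"
      by blast
  qed
  then obtain x where x: "X \<longlonglongrightarrow> x"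
    using Cauchy_convergent_iff convergent_def by blast
  have "x \<in> C"
    using closed_sequentially[OF assms(2)] XC x by blast
  moreover have "norm x = d"
    using LIMSEQ_unique[OF tendsto_norm[OF x] lim] .
  ultimately show ?thesis
    using that d_le by blast
qed

text \<open>The vector of least norm in the hyperplane where \<phi> equals 1 is orthogonal to the
  kernel of \<phi>, so a multiple of it represents \<phi>.\<close>

lemma Riesz_representation:
  fixes \<phi> :: "'a::complex_hilbert \<Rightarrow> complex"
  assumes "bounded_linear \<phi>" and scale: "\<And>c x. \<phi> (c *\<^sub>C x) = c * \<phi> x"
  obtains z where "\<And>x. \<phi> x = cinner x z"
proof (cases "\<forall>x. \<phi> x = 0")
  case True
  then show ?thesis
    using that[of 0] by simp
next
  case False
  interpret \<phi>: bounded_linear \<phi> by fact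
  from False obtain a where a: "\<phi> a \<noteq> 0"
    by blast
  obtain x0 where x0: "\<phi> x0 = 1" and min: "\<And>y. \<phi> y = 1 \<Longrightarrow> norm x0 \<le> norm y"
  proof (rule exists_minimal_norm[of "\<phi> -` {1}"])
    have "\<phi> (inverse (\<phi> a) *\<^sub>C a) = 1"
      using a by (simp add: scale)
    then show "\<phi> -` {1} \<noteq> {}"
      by blast
    show "closed (\<phi> -` {1})"
      by (intro closed_vimage) (auto intro: \<phi>.continuous_on continuous_on_id)
    show "convex (\<phi> -` {1})"
      by (auto simp: convex_def \<phi>.add \<phi>.scaleR scaleR_left_distrib[symmetric]
          simp flip: of_real_add)
  qed auto
  have orth_Re: "Re (cinner x0 h) = 0" if h: "\<phi> h = 0" for h
  proof (rule ccontr)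
    assume r: "Re (cinner x0 h) \<noteq> 0"
    define r where "r = Re (cinner x0 h)"
    have "h \<noteq> 0"
      using r by auto
    \<comment> \<open>This \<open>t\<close> minimizes the quadratic
      \<open>t\<^sup>2 * (norm h)\<^sup>2 + 2 * (t * r)\<close>, whose minimum is negative when
      \<open>r\<close> is nonzero.\<close>
    define t where "t = - r / (norm h)\<^sup>2"
    have "\<phi> (x0 + complex_of_real t *\<^sub>C h) = 1"
      by (simp add: \<phi>.add scale h x0)
    from min[OF this] have "(norm x0)\<^sup>2 \<le> (norm (x0 + complex_of_real t *\<^sub>C h))\<^sup>2"
      by (intro power_mono) auto
    then have "0 \<le> t\<^sup>2 * (norm h)\<^sup>2 + 2 * (t * r)"
      by (simp add: norm_add_square norm_scaleC cinner_scaleC_right power_mult_distrib r_def)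
    also have "\<dots> = - (r\<^sup>2 / (norm h)\<^sup>2)"
      using \<open>h \<noteq> 0\<close> by (simp add: t_def field_simps power2_eq_square)
    also have "\<dots> < 0"
      using r \<open>h \<noteq> 0\<close> by (simp add: r_def)
    finally show False
      by simp
  qed
  have orth: "cinner x0 h = 0" if h: "\<phi> h = 0" for h
  proof -
    \<comment> \<open>Replacing \<open>h\<close> by its multiple by the imaginary unit turns the
      imaginary part into a real part.\<close>
    have "Re (cinner x0 (\<i> *\<^sub>C h)) = 0"
      by (intro orth_Re) (simp add: scale h)
    then show ?thesis
      using orth_Re[OF h] by (simp add: complex_eq_iff cinner_scaleC_right)
  qed
  have "x0 \<noteq> 0"
    using x0 by auto
  then have nz: "cinner x0 x0 \<noteq> 0"
    by (simp add: cinner_eq_zero_iff)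
  have "\<phi> x = cinner x (inverse (cinner x0 x0) *\<^sub>C x0)" for x
  proof -
    \<comment> \<open>The vector \<open>x - \<phi> x *\<^sub>C x0\<close> lies in the kernel of
      \<phi>.\<close>
    have "cinner x0 (x - \<phi> x *\<^sub>C x0) = 0"
      by (intro orth) (simp add: \<phi>.diff scale x0)
    then have "cinner x0 x = cnj (\<phi> x) * cinner x0 x0"
      by (simp add: cinner_diff_right cinner_scaleC_right)
    then have "cinner x x0 = \<phi> x * cinner x0 x0"
      by (metis cinner_commute complex_cnj_cnj complex_cnj_mult)
    moreover have "cnj (cinner x0 x0) = cinner x0 x0"
      using cinner_commute by metis
    ultimately show ?thesis
      using nz by (simp add: cinner_scaleC_right)
  qed
  then show ?thesis
    using that by blast
qed

section \<open>Rank-one operators\<close>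

lemma bounded_opsI:
  assumes "\<And>x y. T (x + y) = T x + T y" "\<And>c x. T (c *\<^sub>C x) = c *\<^sub>C T x"
    and "\<And>x. norm (T x) \<le> norm x * K"
  shows "(T :: 'a::complex_hilbert \<Rightarrow> 'a) \<in> bounded_ops"
  unfolding bounded_ops_def
  using assms by (auto intro!: bounded_linear_intro[of T K] simp: scaleR_scaleC)

lemma bounded_ops_add: "T \<in> bounded_ops \<Longrightarrow> T (x + y) = T x + T y"
  by (simp add: bounded_ops_def linear_add bounded_linear.linear)

lemma bounded_ops_scaleC: "T \<in> bounded_ops \<Longrightarrow> T (c *\<^sub>C x) = c *\<^sub>C T x"
  by (simp add: bounded_ops_def)

lemma bounded_ops_compose: "S \<in> bounded_ops \<Longrightarrow> T \<in> bounded_ops \<Longrightarrow> S \<circ> T \<in> bounded_ops"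
  by (auto simp: bounded_ops_def o_def intro: bounded_linear_compose)

text \<open>This is the operator written as a tensor \<open>u \<otimes> v\<close> in the
  overview.\<close>

definition rank_one :: "'a::complex_hilbert \<Rightarrow> 'a \<Rightarrow> 'a \<Rightarrow> 'a"
  where "rank_one u v x = cinner x v *\<^sub>C u"

lemma rank_one_bounded [simp]: "rank_one u v \<in> bounded_ops"
proof (rule bounded_opsI)
  show "norm (rank_one u v x) \<le> norm x * (norm v * norm u)" for x
    using mult_right_mono[OF Cauchy_Schwarz_cinner[of x v], of "norm u"]
    by (simp add: rank_one_def norm_scaleC mult.assoc)
qed (simp_all add: rank_one_def cinner_add_left cinner_scaleC_left scaleC_add_left scaleC_scaleC)

lemma compose_rank_one: "T \<in> bounded_ops \<Longrightarrow> T \<circ> rank_one u v = rank_one (T u) v"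
  by (simp add: fun_eq_iff rank_one_def bounded_ops_scaleC)

text \<open>Definiteness of the inner product leaves at most one adjoint, so exhibiting one
  evaluates the \<open>THE\<close>.\<close>

lemma cadjoint_eqI:
  fixes T :: "'a::complex_hilbert \<Rightarrow> 'a"
  assumes "S \<in> bounded_ops" "\<And>x y. cinner (T x) y = cinner x (S y)"
  shows "cadjoint T = S"
  unfolding cadjoint_def
proof (rule the_equality)
  fix S'
  assume "S' \<in> bounded_ops \<and> (\<forall>x y. cinner (T x) y = cinner x (S' y))"
  then show "S' = S"
    using assms(2) by (auto simp: fun_eq_iff intro: cinner_ext)
qed (use assms in simp)

lemma cadjoint_rank_one: "cadjoint (rank_one u v) = rank_one v u"
proof (rule cadjoint_eqI)
  show "cinner (rank_one u v x) y = cinner x (rank_one v u y)" for x y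
    using cinner_commute[of u y]
    by (simp add: rank_one_def cinner_scaleC_left cinner_scaleC_right)
qed simp

text \<open>The coefficient of \<open>T x\<close> along \<open>f\<close> is a bounded complex-linear
  functional of \<open>x\<close>; its Riesz vector is \<open>z\<close>.\<close>

lemma rank_one_of_range:
  assumes T: "T \<in> bounded_ops" and range: "\<And>x. \<exists>c. T x = c *\<^sub>C f"
  obtains z where "T = rank_one f z"
proof (cases "f = 0")
  case True
  then have "T = rank_one f 0"
    using range by (auto simp: fun_eq_iff rank_one_def)
  then show ?thesis
    using that by blast
next
  case False
  then have nz: "cinner f f \<noteq> 0"
    by (simp add: cinner_eq_zero_iff)
  define \<phi> where "\<phi> x = cinner (T x) f / cinner f f" for x
  have T_eq: "T x = \<phi> x *\<^sub>C f" for x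
    using range[of x] nz by (auto simp: \<phi>_def cinner_scaleC_left)
  have scale: "\<phi> (c *\<^sub>C x) = c * \<phi> x" for c x
    by (simp add: \<phi>_def bounded_ops_scaleC[OF T] cinner_scaleC_left)
  have bl: "bounded_linear T"
    using T by (simp add: bounded_ops_def)
  obtain K where K: "norm (T x) \<le> norm x * K" for x
    using bounded_linear.bounded[OF bl] by blast
  have "bounded_linear \<phi>"
  proof (rule bounded_linear_intro[of _ "K / norm f"])
    show "\<phi> (x + y) = \<phi> x + \<phi> y" for x y
      by (simp add: \<phi>_def bounded_ops_add[OF T] cinner_add_left add_divide_distrib)
    show "\<phi> (r *\<^sub>R x) = r *\<^sub>R \<phi> x" for r x
      using scale[of "complex_of_real r" x]
      by (simp add: scaleR_conv_of_real flip: scaleR_scaleC)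
    show "norm (\<phi> x) \<le> norm x * (K / norm f)" for x
      using K[of x] False by (simp add: T_eq norm_scaleC field_simps)
  qed
  then obtain z where "\<And>x. \<phi> x = cinner x z"
    using scale by (rule Riesz_representation) blast
  then have "T = rank_one f z"
    by (simp add: fun_eq_iff T_eq rank_one_def)
  then show ?thesis
    using that by blast
qed

section \<open>The implementing conjugate-linear unitary\<close>

theorem proposition2p7:
  fixes sharp :: "('a::complex_hilbert \<Rightarrow> 'a) \<Rightarrow> ('a \<Rightarrow> 'a)"
  assumes "star_conjugate_automorphism sharp"
  shows "\<exists>U. conjugate_linear_unitary U \<and> (\<forall>T\<in>bounded_ops. sharp T = U \<circ> T \<circ> inv U)"
\<comment> \<open>The zero space has no unit vector to start from; there the identity works.\<close>
proof (cases "\<forall>x::'a. x = 0")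
  case True
  then have "x = y" for x y :: 'a
    by metis
  then have "conjugate_linear_unitary (id :: 'a \<Rightarrow> 'a)"
    and "\<forall>T\<in>bounded_ops. sharp T = id \<circ> T \<circ> inv id"
    by (auto simp: conjugate_linear_unitary_def conjugate_linear_def fun_eq_iff
        intro: arg_cong2[of _ _ _ _ cinner])
  then show ?thesis
    by blast
next
  case False
  then obtain e0 :: 'a where "e0 \<noteq> 0"
    by blast
  define e where "e = (1 / norm e0) *\<^sub>R e0"
  have ee: "cinner e e = 1"
    using \<open>e0 \<noteq> 0\<close> by (simp add: cinner_self e_def)

  have bounded: "sharp A \<in> bounded_ops" if "A \<in> bounded_ops" for A
    using assms that by (simp add: star_conjugate_automorphism_def)
  have linear: "sharp (\<lambda>x. c *\<^sub>C A x + B x) = (\<lambda>x. cnj c *\<^sub>C sharp A x + sharp B x)"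
    if "A \<in> bounded_ops" "B \<in> bounded_ops" for A B c
    using assms that by (simp add: star_conjugate_automorphism_def)
  have invol: "sharp (sharp A) = A" if "A \<in> bounded_ops" for A
    using assms that by (simp add: star_conjugate_automorphism_def)
  have adj: "cadjoint (sharp A) = sharp (cadjoint A)" if "A \<in> bounded_ops" for A
    using assms that by (simp add: star_conjugate_automorphism_def)
  have mult: "sharp (A \<circ> B) = sharp A \<circ> sharp B"
    if "A \<in> bounded_ops" "B \<in> bounded_ops" for A B
    using assms that by (simp add: star_conjugate_automorphism_def)
  have zero_op: "(\<lambda>x. 0) \<in> (bounded_ops :: ('a \<Rightarrow> 'a) set)"
    by (rule bounded_opsI[of _ 0]) auto
  \<comment> \<open>Additivity at the zero operator gives
    \<open>sharp 0 = sharp 0 + sharp 0\<close>.\<close>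
  have sharp_zero: "sharp (\<lambda>x. 0) = (\<lambda>x. 0)"
    using linear[OF zero_op zero_op, of 1] by (simp add: fun_eq_iff)
  have scale: "sharp (\<lambda>x. c *\<^sub>C A x) = (\<lambda>x. cnj c *\<^sub>C sharp A x)" if "A \<in> bounded_ops" for A c
    using linear[OF that zero_op, of c] by (simp add: sharp_zero)

  \<comment> \<open>The image of a rank-one projection\<close>
  define P where "P = rank_one e e"
  define Q where "Q = sharp P"
  have P: "P \<in> bounded_ops"
    by (simp add: P_def)
  have Q: "Q \<in> bounded_ops"
    by (simp add: Q_def bounded P)
  have Pe: "P e = e"
    by (simp add: P_def rank_one_def ee)
  have PP: "P \<circ> P = P"
    using compose_rank_one[OF P, of e e] by (simp add: Pe flip: P_def)
  then have QQ: "Q (Q x) = Q x" for x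
    using mult[OF P P] by (metis Q_def comp_apply)
  have "Q \<noteq> (\<lambda>x. 0)"
  proof
    assume "Q = (\<lambda>x. 0)"
    then have "P = (\<lambda>x. 0)"
      using invol[OF P] sharp_zero by (simp add: Q_def)
    then have "e = 0"
      using Pe by metis
    then show False
      using ee by simp
  qed
  then obtain v where v: "Q v \<noteq> 0"
    by blast
  \<comment> \<open>Any normalized vector in the range of \<open>Q\<close> will do; idempotence
    makes \<open>Q\<close> fix it.\<close>
  define f where "f = (1 / norm (Q v)) *\<^sub>R Q v"
  have ff: "cinner f f = 1"
    using v by (simp add: cinner_self f_def)
  have Qf: "Q f = f"
    by (simp add: f_def scaleR_scaleC bounded_ops_scaleC[OF Q] QQ)

  \<comment> \<open>Minimality of \<open>P\<close>: compressing any operator by \<open>P\<close>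
    yields a multiple of \<open>P\<close>. Since \<open>S\<close> is the image of
    \<open>sharp S\<close>, this property carries over to \<open>Q\<close>.\<close>
  have corner: "\<exists>c. Q \<circ> S \<circ> Q = (\<lambda>x. c *\<^sub>C Q x)" if S: "S \<in> bounded_ops" for S
  proof -
    let ?T = "sharp S"
    have T: "?T \<in> bounded_ops"
      using bounded S .
    have "P \<circ> ?T \<circ> P = (\<lambda>x. cinner (?T e) e *\<^sub>C P x)"
      by (simp add: fun_eq_iff P_def rank_one_def bounded_ops_scaleC[OF T] cinner_scaleC_left
          scaleC_scaleC mult.commute)
    then have "sharp (P \<circ> ?T \<circ> P) = (\<lambda>x. cnj (cinner (?T e) e) *\<^sub>C Q x)"
      by (simp add: scale P Q_def)
    moreover have "sharp (P \<circ> ?T \<circ> P) = Q \<circ> S \<circ> Q"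
      by (simp add: mult bounded_ops_compose P T invol S Q_def)
    ultimately show ?thesis
      by metis
  qed
  have "\<exists>c. Q x = c *\<^sub>C f" for x
  proof -
    \<comment> \<open>As \<open>rank_one x f\<close> sends \<open>f\<close> to \<open>x\<close>, the
      compression evaluated at \<open>f\<close> is \<open>Q x\<close>, while the right-hand side
      becomes a multiple of \<open>f\<close>.\<close>
    obtain c where "Q \<circ> rank_one x f \<circ> Q = (\<lambda>x. c *\<^sub>C Q x)"
      using corner[OF rank_one_bounded] by blast
    from fun_cong[OF this, of f] show ?thesis
      by (auto simp: Qf rank_one_def ff)
  qed
  then obtain z where z: "Q = rank_one f z"
    using rank_one_of_range[OF Q] by blast
  \<comment> \<open>\<open>P\<close> is self-adjoint, hence so is \<open>Q\<close>; evaluation at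
    \<open>f\<close> then identifies \<open>z\<close>.\<close>
  have "rank_one z f = rank_one f z"
    using adj[OF P] by (simp add: P_def Q_def[unfolded P_def, symmetric] cadjoint_rank_one z)
  from fun_cong[OF this, of f] have "z = f"
    using Qf by (simp add: z rank_one_def ff)
  with z have Qff: "Q = rank_one f f"
    by simp

  \<comment> \<open>Construction and properties of \<open>U\<close>\<close>
  define U where "U x = sharp (rank_one x e) f" for x
  have sharp_rank_one: "sharp (rank_one x e) = rank_one (U x) f" for x
  proof -
    \<comment> \<open>Absorbing \<open>P\<close> on the right becomes absorbing \<open>Q\<close>,
      which forces the image to be rank one with second vector \<open>f\<close>.\<close>
    have "rank_one x e = rank_one x e \<circ> P"
      unfolding P_def by (simp add: compose_rank_one) (simp add: rank_one_def ee)
    then have "sharp (rank_one x e) = sharp (rank_one x e) \<circ> Q"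
      using mult[OF rank_one_bounded P] by (metis Q_def)
    then show ?thesis
      by (simp add: Qff compose_rank_one bounded U_def)
  qed
  have sharp_rank_one': "sharp (rank_one e x) = rank_one f (U x)" for x
    using adj[of "rank_one x e"] by (simp add: sharp_rank_one cadjoint_rank_one)

  have U_lin: "U (c *\<^sub>C x + y) = cnj c *\<^sub>C U x + U y" for c x y
  proof -
    have "rank_one (c *\<^sub>C x + y) e = (\<lambda>w. c *\<^sub>C rank_one x e w + rank_one y e w)"
      by (simp add: fun_eq_iff rank_one_def scaleC_add_right scaleC_scaleC mult.commute)
    then show ?thesis
      by (simp add: U_def linear)
  qed
  have U_zero: "U 0 = 0"
    using U_lin[of "-1" 0 0] by (simp add: scaleC_minus_left)
  have "conjugate_linear U"
    unfolding conjugate_linear_def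
    using U_lin[of 1] U_lin[of _ _ 0] by (simp add: U_zero)
  have U_inner: "cinner (U x) (U y) = cinner y x" for x y
  proof -
    have "rank_one e y \<circ> rank_one x e = (\<lambda>w. cinner x y *\<^sub>C P w)"
      by (simp add: fun_eq_iff rank_one_def P_def cinner_scaleC_left scaleC_scaleC mult.commute)
    then have "sharp (rank_one e y) \<circ> sharp (rank_one x e) = (\<lambda>w. cnj (cinner x y) *\<^sub>C Q w)"
      by (simp add: scale P Q_def flip: mult)
    \<comment> \<open>Evaluation at \<open>f\<close> reduces the operator identity to scalars;
      pairing with the unit vector \<open>f\<close> then isolates them.\<close>
    then have "rank_one f (U y) (rank_one (U x) f f) = cnj (cinner x y) *\<^sub>C f"
      using Qf by (simp add: sharp_rank_one sharp_rank_one' fun_eq_iff)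
    then have "cinner (U x) (U y) *\<^sub>C f = cinner y x *\<^sub>C f"
      using cinner_commute[of y x] by (simp add: rank_one_def ff)
    from arg_cong[OF this, of "\<lambda>w. cinner w f"] show ?thesis
      by (simp add: cinner_scaleC_left ff)
  qed
  have intertwine: "sharp T (U x) = U (T x)" if T: "T \<in> bounded_ops" for T x
    using fun_cong[OF mult[OF T rank_one_bounded[of x e]], of f]
    by (simp add: compose_rank_one T U_def)
  have "surj U"
    unfolding surj_def
  proof
    fix y
    let ?S = "rank_one y f"
    \<comment> \<open>Intertwining for \<open>sharp ?S\<close>, whose image is \<open>?S\<close>
      again, moves \<open>U\<close> past it; \<open>?S\<close> is chosen to send
      \<open>f = U e\<close> to \<open>y\<close>.\<close>
    have "U (sharp ?S e) = ?S (U e)"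
      by (simp add: bounded invol flip: intertwine)
    also have "U e = f"
      using Qf by (simp add: U_def Q_def P_def)
    also have "?S f = y"
      by (simp add: rank_one_def ff)
    finally show "\<exists>x. y = U x"
      by metis
  qed
  have "inj U"
  proof (rule injI)
    fix x y
    assume "U x = U y"
    then have "cinner w x = cinner w y" for w
      by (metis U_inner)
    then show "x = y"
      by (rule cinner_ext)
  qed
  \<comment> \<open>By surjectivity every vector is \<open>U\<close> of its \<open>inv U\<close>
    value, where the intertwining relation applies.\<close>
  have "sharp T = U \<circ> T \<circ> inv U" if "T \<in> bounded_ops" for T
    using intertwine[OF that, of "inv U _"] \<open>surj U\<close> by (simp add: fun_eq_iff surj_f_inv_f)
  moreover have "conjugate_linear_unitary U"
    using \<open>conjugate_linear U\<close> \<open>surj U\<close> U_inner by (simp add: conjugate_linear_unitary_def)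
  ultimately show ?thesis
    by blast
qed

end
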